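(* Let $p$ be an odd prime and $q\in\mathbb{C}_p$ with $|1-q|_p<1$. Let $s\ge1$ and $k,n_1,\dots,n_s\ge0$ be integers. Then $$\int_{\mathbb{Z}_p}\Bigl(\prod_{i=1}^sB_{k,n_i}(x,q)\Bigr)d\mu_{-1}(x)=\Bigl(\prod_{i=1}^s\binom{n_i}{k}\Bigr)\sum_{j=0}^{\sum_{i=1}^s n_i-sk}\binom{\sum_{i=1}^s n_i-sk}{j}(-1)^jE_{j+sk,q}.$$
   Context: $\mathbb{Z}_p$, $\mathbb{C}_p$ are the $p$-adic integers and the completion of an algebraic closure of $\mathbb{Q}_p$, with $|p|_p=1/p$. For $r\in\mathbb{C}_p$ with $|1-r|_p<1$ and $y\in\mathbb{Z}_p$, $[y]_r=\frac{1-r^y}{1-r}$ (interpreted as $y$ if $r=1$). For integers $k,n\ge0$ and $x\in\mathbb{Z}_p$, $B_{k,n}(x,q)=\binom nk[x]_q^k[1-x]_{1/q}^{\,n-k}$ if $0\le k\le n$ and $B_{k,n}(x,q)=0$ if $k>n$. For a uniformly differentiable $f:\mathbb{Z}_p\to\mathbb{C}_p$, the fermionic $p$-adic integral is $\int_{\mathbb{Z}_p}f(x)\,d\mu_{-1}(x)=\lim_{N\to\infty}\sum_{x=0}^{p^N-1}f(x)(-1)^x$. The $q$-Euler numbers are $E_{n,q}=\int_{\mathbb{Z}_p}[x]_q^n\,d\mu_{-1}(x)$, equivalently $E_{n,q}=\frac{2}{(1-q)^n}\sum_{l=0}^n\binom nl\frac{(-1)^l}{1+q^l}$. An empty sum is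 $0$. *)

theory Defs
  imports Complex_Main
    "HOL-Computational_Algebra.Primes"
    "HOL-Computational_Algebra.Polynomial"
begin

definition v_tendsto :: "('a::field_char_0 \<Rightarrow> real) \<Rightarrow> (nat \<Rightarrow> 'a) \<Rightarrow> 'a \<Rightarrow> bool" where
  "v_tendsto v X l \<longleftrightarrow> (\<lambda>n. v (X n - l)) \<longlonglongrightarrow> 0"

definition v_cauchy :: "('a::field_char_0 \<Rightarrow> real) \<Rightarrow> (nat \<Rightarrow> 'a) \<Rightarrow> bool" where
  "v_cauchy v X \<longleftrightarrow> (\<forall>e>0. \<exists>M. \<forall>m\<ge>M. \<forall>n\<ge>M. v (X m - X n) < e)"

definition v_closure :: "('a::field_char_0 \<Rightarrow> real) \<Rightarrow> 'a set \<Rightarrow> 'a set" where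
  "v_closure v S = {x. \<forall>e>0. \<exists>s\<in>S. v (x - s) < e}"

text \<open>
  All notions below live inside one ambient valued field, which plays the role of
  \<open>\<complex>\<^sub>p\<close>. As that field is complete, the closure of \<open>\<rat>\<close> in it is the completion of \<open>\<rat>\<close>
  with respect to the \<open>p\<close>-adic absolute value, i.e. \<open>\<rat>\<^sub>p\<close>.
\<close>

definition Qp :: "('a::field_char_0 \<Rightarrow> real) \<Rightarrow> 'a set" where
  "Qp v = v_closure v \<rat>"

definition Zp :: "('a::field_char_0 \<Rightarrow> real) \<Rightarrow> 'a set" where
  "Zp v = {x \<in> Qp v. v x \<le> 1}"

definition Qp_alg :: "('a::field_char_0 \<Rightarrow> real) \<Rightarrow> 'a set" where
  "Qp_alg v = {z. \<exists>f. f \<noteq> 0 \<and> (\<forall>i. coeff f i \<in> Qp v) \<and> poly f z = 0}"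

text \<open>
  The field \<open>'a\<close> with the absolute value \<open>v\<close> is the completion of an algebraic closure of
  \<open>\<rat>\<^sub>p\<close>: it is complete, the elements algebraic over \<open>\<rat>\<^sub>p\<close> form an algebraically closed
  subfield (hence an algebraic closure of \<open>\<rat>\<^sub>p\<close>), and this subfield is dense. By uniqueness
  of the algebraic closure, of the extension of the absolute value and of the completion,
  this determines the valued field up to isometric isomorphism.
\<close>

locale is_Cp =
  fixes p :: nat and v :: "'a::field_char_0 \<Rightarrow> real"
  assumes v_nonneg: "0 \<le> v x"
    and v_eq_0: "v x = 0 \<longleftrightarrow> x = 0"
    and v_mult: "v (x * y) = v x * v y"
    and v_ultrametric: "v (x + y) \<le> max (v x) (v y)"
    and v_p: "v (of_nat p) = 1 / real p"
    and v_complete: "v_cauchy v X \<Longrightarrow> \<exists>l. v_tendsto v X l"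
    and alg_closed:
      "\<lbrakk>\<forall>i. coeff f i \<in> Qp_alg v; 0 < degree f\<rbrakk> \<Longrightarrow> \<exists>z\<in>Qp_alg v. poly f z = 0"
    and alg_dense: "v_closure v (Qp_alg v) = UNIV"

text \<open>
  For \<open>v (1 - r) < 1\<close> and \<open>y\<close> a \<open>p\<close>-adic integer, \<open>r\<^sup>y\<close> is the value at \<open>y\<close> of the continuous
  extension of \<open>n \<mapsto> r ^ n\<close> from \<open>\<nat>\<close>, which is dense in \<open>\<int>\<^sub>p\<close>.
\<close>

definition v_pow :: "('a::field_char_0 \<Rightarrow> real) \<Rightarrow> 'a \<Rightarrow> 'a \<Rightarrow> 'a" where
  "v_pow v r y =
    (THE l. \<forall>a. v_tendsto v (\<lambda>n. of_nat (a n)) y \<longrightarrow> v_tendsto v (\<lambda>n. r ^ a n) l)"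

definition q_number :: "('a::field_char_0 \<Rightarrow> real) \<Rightarrow> 'a \<Rightarrow> 'a \<Rightarrow> 'a" where
  "q_number v r y = (if r = 1 then y else (1 - v_pow v r y) / (1 - r))"

definition q_bernstein :: "('a::field_char_0 \<Rightarrow> real) \<Rightarrow> nat \<Rightarrow> nat \<Rightarrow> 'a \<Rightarrow> 'a \<Rightarrow> 'a" where
  "q_bernstein v k n x q =
    (if k \<le> n
     then of_nat (n choose k) * q_number v q x ^ k * q_number v (1 / q) (1 - x) ^ (n - k)
     else 0)"

text \<open>
  Uniform differentiability on \<open>\<int>\<^sub>p\<close>. As \<open>\<int>\<^sub>p\<close> is compact, this is the same as asking that
  the difference quotient has a limit as \<open>(x, y) \<rightarrow> (a, a)\<close>, \<open>x \<noteq> y\<close>, for every \<open>a\<close> in \<open>\<int>\<^sub>p\<close>.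
\<close>

definition uniformly_differentiable ::
    "('a::field_char_0 \<Rightarrow> real) \<Rightarrow> ('a \<Rightarrow> 'a) \<Rightarrow> bool" where
  "uniformly_differentiable v f \<longleftrightarrow>
    (\<exists>f'. \<forall>e>0. \<exists>d>0. \<forall>x\<in>Zp v. \<forall>y\<in>Zp v.
       x \<noteq> y \<and> v (x - y) < d \<longrightarrow> v ((f x - f y) / (x - y) - f' x) < e)"

definition has_fermionic_integral ::
    "nat \<Rightarrow> ('a::field_char_0 \<Rightarrow> real) \<Rightarrow> ('a \<Rightarrow> 'a) \<Rightarrow> 'a \<Rightarrow> bool" where
  "has_fermionic_integral p v f I \<longleftrightarrow>
    uniformly_differentiable v f \<and>
    v_tendsto v (\<lambda>N. \<Sum>x<p ^ N. f (of_nat x) * (-1) ^ x) I"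

definition fermionic_integral ::
    "nat \<Rightarrow> ('a::field_char_0 \<Rightarrow> real) \<Rightarrow> ('a \<Rightarrow> 'a) \<Rightarrow> 'a" where
  "fermionic_integral p v f = (THE I. has_fermionic_integral p v f I)"

definition q_euler :: "nat \<Rightarrow> ('a::field_char_0 \<Rightarrow> real) \<Rightarrow> nat \<Rightarrow> 'a \<Rightarrow> 'a" where
  "q_euler p v n q = fermionic_integral p v (\<lambda>x. q_number v q x ^ n)"

end

theory Submission
  imports Defs
begin

text \<open>
  The reflection \<open>[1 - x]\<^bsub>1/q\<^esub> = 1 - [x]\<^bsub>q\<^esub>\<close> turns the product of Bernstein polynomials, when all
  \<open>n\<^sub>i \<ge> k\<close>, into a constant times \<open>[x]\<^bsub>q\<^esub>\<^bsup>sk\<^esup> (1 - [x]\<^bsub>q\<^esub>)\<^bsup>n\<^sub>1 + \<dots> + n\<^sub>s - sk\<^esup>\<close>; expanding binomially and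
  integrating the powers of \<open>[x]\<^bsub>q\<^esub>\<close> term by term gives the formula. If some \<open>n\<^sub>i < k\<close>, both sides vanish.

  The analytic content is that \<open>x \<mapsto> q\<^sup>x\<close> is well defined and uniformly differentiable on \<open>\<int>\<^sub>p\<close> and
  that such functions have a fermionic integral. From \<open>v (q - 1) < 1\<close> one gets \<open>q ^ p ^ M \<rightarrow> 1\<close>,
  which yields the continuous extension of \<open>m \<mapsto> q ^ m\<close>. For \<open>w\<close> small, \<open>(1 + w) ^ m - 1 - m w\<close> is
  bounded by \<open>2 v(m) v(w)\<^sup>2\<close>; applied to \<open>w = q ^ p ^ M - 1\<close> it shows that \<open>(q ^ p ^ M - 1) / p ^ M\<close>
  converges and that its limit is the derivative of \<open>q\<^sup>x\<close> at \<open>0\<close>.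
\<close>

subsection \<open>Ultrametric absolute values\<close>

context is_Cp
begin

lemma v_zero [simp]: "v 0 = 0"
  by (simp add: v_eq_0)

lemma v_one [simp]: "v 1 = 1"
proof -
  have "v 1 * v 1 = v 1" using v_mult[of 1 1] by simp
  moreover have "v 1 \<noteq> 0" by (simp add: v_eq_0)
  ultimately show ?thesis by simp
qed

lemma v_minus [simp]: "v (- x) = v x"
proof -
  have "v (- 1) * v (- 1) = 1" using v_mult[of "-1" "-1"] by simp
  then have "v (- 1) = 1"
    using v_nonneg[of "-1"] by (metis abs_of_nonneg real_sqrt_abs2 real_sqrt_one)
  then show ?thesis using v_mult[of "-1" x] by simp
qed

lemma v_pos: "x \<noteq> 0 \<Longrightarrow> 0 < v x"
  using v_nonneg[of x] v_eq_0[of x] by linarith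

lemma v_minus_commute: "v (x - y) = v (y - x)"
  using v_minus[of "x - y"] by simp

lemma v_power: "v (x ^ n) = v x ^ n"
  by (induction n) (simp_all add: v_mult)

lemma v_divide: "v (x / y) = v x / v y"
proof (cases "y = 0")
  case False
  then have "v (x / y) * v y = v x" using v_mult[of "x / y" y] by simp
  moreover have "v y \<noteq> 0" using False by (simp add: v_eq_0)
  ultimately show ?thesis by (simp add: field_simps)
qed simp

lemma v_diff_ultrametric: "v (x - y) \<le> max (v x) (v y)"
  using v_ultrametric[of x "- y"] by simp

lemma v_add_le: "v x \<le> B \<Longrightarrow> v y \<le> B \<Longrightarrow> v (x + y) \<le> B"
  using v_ultrametric[of x y] by simp

lemma v_diff_le: "v x \<le> B \<Longrightarrow> v y \<le> B \<Longrightarrow> v (x - y) \<le> B"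
  using v_diff_ultrametric[of x y] by simp

lemma v_triangle: "v (x + y) \<le> v x + v y"
  using v_ultrametric[of x y] v_nonneg[of x] v_nonneg[of y] by linarith

lemma v_sum_le:
  assumes "\<And>i. i \<in> A \<Longrightarrow> v (f i) \<le> B" and "0 \<le> B"
  shows "v (sum f A) \<le> B"
  using assms by (induction A rule: infinite_finite_induct) (auto intro: v_add_le)

lemma v_of_nat_le_1: "v (of_nat n) \<le> 1"
  by (induction n) (auto intro: v_add_le)

lemma v_of_int_le_1: "v (of_int n) \<le> 1"
  by (cases n) (simp_all add: v_of_nat_le_1 v_diff_le del: of_nat_Suc)

lemma v_abs_diff_le: "\<bar>v x - v y\<bar> \<le> v (x - y)"
  using v_triangle[of "x - y" y] v_triangle[of "y - x" x] v_minus_commute[of x y] by simp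

section \<open>Limits and Cauchy sequences with respect to \<open>v\<close>\<close>

lemma v_tendsto_unique:
  assumes "v_tendsto v X l" and "v_tendsto v X m"
  shows "l = m"
proof -
  have "(\<lambda>n. v (X n - m) + v (X n - l)) \<longlonglongrightarrow> 0 + 0"
    using assms unfolding v_tendsto_def by (intro tendsto_add)
  moreover have "v (l - m) \<le> v (X n - m) + v (X n - l)" for n
    using v_triangle[of "X n - m" "l - X n"] v_minus_commute[of l "X n"] by simp
  ultimately have "v (l - m) \<le> 0"
    by (intro LIMSEQ_le_const[where X = "\<lambda>n. v (X n - m) + v (X n - l)"]) auto
  then have "v (l - m) = 0" using v_nonneg[of "l - m"] by linarith
  then show ?thesis by (simp add: v_eq_0)
qed

lemma v_tendsto_const: "v_tendsto v (\<lambda>_. c) c"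
  by (simp add: v_tendsto_def)

lemma v_tendsto_norm: "v_tendsto v X l \<Longrightarrow> (\<lambda>n. v (X n)) \<longlonglongrightarrow> v l"
  unfolding v_tendsto_def
  by (rule LIMSEQ_I, drule LIMSEQ_D, assumption)
    (metis (no_types, lifting) abs_of_nonneg diff_zero le_less_trans real_norm_def
      v_abs_diff_le v_nonneg)

lemma v_tendsto_squeeze:
  assumes "\<And>n. v (X n - l) \<le> f n" and "f \<longlonglongrightarrow> 0"
  shows "v_tendsto v X l"
  unfolding v_tendsto_def
  by (rule tendsto_sandwich[OF _ _ tendsto_const assms(2)]) (simp_all add: assms(1) v_nonneg)

lemma v_tendsto_add:
  assumes "v_tendsto v X l" and "v_tendsto v Y m"
  shows "v_tendsto v (\<lambda>n. X n + Y n) (l + m)"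
proof (rule v_tendsto_squeeze)
  show "v (X n + Y n - (l + m)) \<le> v (X n - l) + v (Y n - m)" for n
    using v_triangle[of "X n - l" "Y n - m"] by (simp add: algebra_simps)
  show "(\<lambda>n. v (X n - l) + v (Y n - m)) \<longlonglongrightarrow> 0"
    using tendsto_add[OF assms[unfolded v_tendsto_def]] by simp
qed

lemma v_tendsto_mult:
  assumes "v_tendsto v X l" and "v_tendsto v Y m"
  shows "v_tendsto v (\<lambda>n. X n * Y n) (l * m)"
proof (rule v_tendsto_squeeze)
  show "v (X n * Y n - l * m) \<le> v (X n) * v (Y n - m) + v (X n - l) * v m" for n
    using v_triangle[of "X n * (Y n - m)" "(X n - l) * m"]
    unfolding v_mult by (simp add: algebra_simps)
  show "(\<lambda>n. v (X n) * v (Y n - m) + v (X n - l) * v m) \<longlonglongrightarrow> 0"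
    using tendsto_add[OF tendsto_mult[OF v_tendsto_norm[OF assms(1)] assms(2)[unfolded v_tendsto_def]]
        tendsto_mult[OF assms(1)[unfolded v_tendsto_def] tendsto_const[of "v m"]]] by simp
qed

lemma v_tendsto_diff:
  assumes "v_tendsto v X l" and "v_tendsto v Y m"
  shows "v_tendsto v (\<lambda>n. X n - Y n) (l - m)"
  using v_tendsto_add[OF assms(1) v_tendsto_mult[OF v_tendsto_const[of "-1"] assms(2)]] by simp

lemma v_tendstoD: "v_tendsto v X l \<Longrightarrow> 0 < e \<Longrightarrow> \<exists>N. \<forall>n\<ge>N. v (X n - l) < e"
  unfolding v_tendsto_def by (drule LIMSEQ_D, assumption) (simp add: v_nonneg)

lemma v_tendstoI: "(\<And>e. 0 < e \<Longrightarrow> \<exists>N. \<forall>n\<ge>N. v (X n - l) < e) \<Longrightarrow> v_tendsto v X l"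
  unfolding v_tendsto_def by (rule LIMSEQ_I) (simp add: v_nonneg)

lemma v_tendsto_le:
  assumes "v_tendsto v X l" and "\<forall>n\<ge>N. v (X n) \<le> B"
  shows "v l \<le> B"
  using LIMSEQ_le_const2[OF v_tendsto_norm[OF assms(1)]] assms(2) by blast

lemma v_tendsto_cauchy:
  assumes "v_tendsto v X l"
  shows "v_cauchy v X"
  unfolding v_cauchy_def
proof (intro allI impI)
  fix e :: real assume "0 < e"
  then obtain N where N: "\<forall>n\<ge>N. v (X n - l) < e"
    using v_tendstoD[OF assms] by blast
  have "v (X m - X n) < e" if "m \<ge> N" "n \<ge> N" for m n
    using v_diff_ultrametric[of "X m - l" "X n - l"] N[rule_format, OF that(1)]
      N[rule_format, OF that(2)] by simp
  then show "\<exists>M. \<forall>m\<ge>M. \<forall>n\<ge>M. v (X m - X n) < e" by blast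
qed

text \<open>In an ultrametric field a telescoping sum is no larger than its largest step, so steps
  tending to 0 already force the Cauchy property. Together with completeness this produces both the
  logarithm and the fermionic integral below.\<close>

lemma v_cauchy_SucI:
  assumes "(\<lambda>n. v (X (Suc n) - X n)) \<longlonglongrightarrow> 0"
  shows "v_cauchy v X"
  unfolding v_cauchy_def
proof (intro allI impI)
  fix e :: real assume "0 < e"
  then obtain N where N: "\<And>n. n \<ge> N \<Longrightarrow> v (X (Suc n) - X n) < e"
    using LIMSEQ_D[OF assms] by (auto simp: v_nonneg)
  have *: "v (X (N + j) - X N) < e" for j
  proof (induction j)
    case (Suc j)
    then show ?case
      using N[of "N + j"] v_ultrametric[of "X (Suc (N + j)) - X (N + j)" "X (N + j) - X N"] by simp
  qed (use \<open>0 < e\<close> in simp)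
  have "v (X m - X n) < e" if "m \<ge> N" "n \<ge> N" for m n
    using v_diff_ultrametric[of "X m - X N" "X n - X N"] *[of "m - N"] *[of "n - N"] that by simp
  then show "\<exists>M. \<forall>m\<ge>M. \<forall>n\<ge>M. v (X m - X n) < e" by blast
qed

end

subsection \<open>Approximation of \<open>p\<close>-adic integers by natural numbers\<close>

text \<open>\<open>is_Cp\<close> does not state that \<open>p\<close> is prime; this extension adds
  it, so that \<open>v\<close> on the integers can be computed from divisibility by
  \<open>p\<close>.\<close>

locale prime_Cp = is_Cp +
  assumes prime_p: "prime p"
begin

lemma p_gt_1: "1 < real p"
  using prime_gt_1_nat[OF prime_p] by simp

lemma v_p_power: "v (of_nat (p ^ N)) = (1 / real p) ^ N"
  by (simp add: v_power v_p)

lemma inverse_p_power_tendsto: "(\<lambda>N. (1 / real p) ^ N) \<longlonglongrightarrow> 0"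
  using p_gt_1 by (intro LIMSEQ_realpow_zero) auto

text \<open>Bezout gives \<open>u * a + w * p = 1\<close>. The summand \<open>w * p\<close> has
  absolute value below 1, so \<open>u * a\<close> must reach 1, and \<open>v u \<le> 1\<close>
  passes this on to \<open>a\<close>.\<close>

lemma v_of_int_not_dvd:
  assumes "\<not> int p dvd a"
  shows "v (of_int a) = 1"
proof -
  have "coprime a (int p)"
    using assms prime_p prime_imp_coprime[of "int p" a] by (simp add: coprime_commute)
  then obtain u w where "u * a + w * int p = 1"
    using bezout_int[of a "int p"] by (metis coprime_imp_gcd_eq_1)
  then have "of_int (u * a + w * int p) = (1 :: 'a)" by (simp only: of_int_1)
  then have "1 \<le> max (v (of_int u * of_int a)) (v (of_int w * of_nat p))"
    using v_ultrametric[of "of_int u * of_int a" "of_int w * of_nat p"] by simp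
  moreover have "v (of_int w * of_nat p) < 1"
    using mult_right_mono[OF v_of_int_le_1[of w], of "1 / real p"] p_gt_1
    by (simp add: v_mult v_p field_simps)
  moreover have "v (of_int u * of_int a) \<le> v (of_int a)"
    using mult_right_mono[OF v_of_int_le_1[of u] v_nonneg] by (simp add: v_mult)
  ultimately show ?thesis using v_of_int_le_1[of a] by linarith
qed

lemma v_of_nat_decompose:
  assumes "m \<noteq> 0"
  obtains e m' where "m = p ^ e * m'" and "\<not> p dvd m'" and "v (of_nat m) = (1 / real p) ^ e"
proof -
  obtain m' where m': "m = p ^ multiplicity p m * m'" "\<not> p dvd m'"
    using multiplicity_decompose'[of m p] assms prime_p by (metis not_prime_unit)
  have "v (of_nat m') = 1"
    using v_of_int_not_dvd[of "int m'"] m'(2) by simp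
  then have "v (of_nat m) = (1 / real p) ^ multiplicity p m"
    by (subst m'(1)) (simp add: v_mult v_p v_power)
  then show ?thesis using that m' by blast
qed

text \<open>Converts closeness to 0 into a factorisation \<open>m = p ^ M * c\<close>, the form in
  which smallness of an exponent is used for powers.\<close>

lemma p_power_dvd_of_v_le:
  assumes "v (of_nat m) \<le> (1 / real p) ^ M"
  shows "p ^ M dvd m"
proof (cases "m = 0")
  case False
  then obtain e m' where e: "m = p ^ e * m'" "v (of_nat m) = (1 / real p) ^ e"
    using v_of_nat_decompose by metis
  then have "(1 / real p) ^ e \<le> (1 / real p) ^ M"
    using assms by simp
  then have "M \<le> e"
    using p_gt_1 by (simp add: power_decreasing_iff)
  then show ?thesis using e(1) by (simp add: le_imp_power_dvd)
qed simp

text \<open>The power of \<open>p\<close> dividing \<open>m\<close> is at most \<open>m\<close>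
  itself. This crude bound controls the denominators in the binomial estimate
  \<open>v_power_linear_approx\<close>.\<close>

lemma inverse_v_of_nat_le:
  assumes "m \<noteq> 0"
  shows "1 / v (of_nat m) \<le> real m"
proof -
  obtain e m' where e: "m = p ^ e * m'" "v (of_nat m) = (1 / real p) ^ e"
    using v_of_nat_decompose[OF assms] by metis
  have "p ^ e \<le> m" using e(1) assms by (intro dvd_imp_le) auto
  then have "real p ^ e \<le> real m" by (metis of_nat_le_iff of_nat_power)
  then show ?thesis by (simp add: e(2) power_one_over)
qed

text \<open>Density of the natural numbers in the \<open>p\<close>-adic integers. A rational
  \<open>a / b\<close> close to \<open>x\<close> has a denominator prime to \<open>p\<close>, since
  its absolute value is at most 1; inverting \<open>b\<close> modulo \<open>p ^ N\<close> then gives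
  a natural number close to \<open>a / b\<close>.\<close>

lemma Zp_nat_approx:
  assumes "x \<in> Zp v" and "0 < e"
  shows "\<exists>m. v (x - of_nat m) < e"
proof -
  \<comment> \<open>The cap at 1 ensures that the approximating rational has absolute value at most
    1, as \<open>x\<close> does.\<close>
  have "0 < min e 1" using assms(2) by simp
  moreover have "\<forall>e>0. \<exists>s\<in>\<rat>. v (x - s) < e" and x: "v x \<le> 1"
    using assms(1) by (simp_all add: Zp_def Qp_def v_closure_def)
  ultimately obtain s where s: "s \<in> \<rat>" "v (x - s) < min e 1" by metis
  obtain a b where ab: "b > 0" "coprime a b" "s = of_int a / of_int b"
    using s(1) by (rule Rats_cases') blast
  have "v s \<le> 1"
    using v_diff_le[of x 1 "x - s"] s(2) x by simp
  have "\<not> int p dvd b"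
  proof
    assume b: "int p dvd b"
    then have "\<not> int p dvd a"
      using ab(2) prime_p by (meson coprime_common_divisor not_prime_unit prime_nat_int_transfer)
    then have "v (of_int a) = 1" by (rule v_of_int_not_dvd)
    moreover have "v (of_int b) < 1"
    proof -
      obtain c where "b = int p * c" using b by blast
      then have "v (of_int b) = v (of_int c) * (1 / real p)" by (simp add: v_mult v_p)
      also have "\<dots> \<le> 1 * (1 / real p)" by (intro mult_right_mono v_of_int_le_1) simp
      also have "\<dots> < 1" using p_gt_1 by simp
      finally show ?thesis .
    qed
    moreover have "v (of_int b) > 0"
      using ab(1) by (intro v_pos) simp
    ultimately show False using \<open>v s \<le> 1\<close> ab(3) by (simp add: v_divide field_simps)
  qed
  then have vb: "v (of_int b) = 1" and cop: "coprime b (int p)"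
    using v_of_int_not_dvd prime_p prime_imp_coprime[of "int p" b] by (simp_all add: coprime_commute)
  obtain N where N: "(1 / real p) ^ N < e"
    using real_arch_pow_inv[of e "1 / real p"] assms(2) p_gt_1 by auto
  have "coprime b (int p ^ N)" using cop by simp
  then obtain u w where uw: "u * b + w * int p ^ N = 1"
    using bezout_int[of b "int p ^ N"] by (metis coprime_imp_gcd_eq_1)
  \<comment> \<open>Modulo \<open>p ^ N\<close>, \<open>u\<close> is the inverse of
    \<open>b\<close>, so \<open>m\<close> represents \<open>a / b\<close>.\<close>
  define m where "m = nat ((a * u) mod int p ^ N)"
  have "int p ^ N > 0" using p_gt_1 by simp
  then have m: "int m = (a * u) mod int p ^ N" by (simp add: m_def)
  have "int p ^ N dvd a * u - int m" by (simp add: m minus_mod_eq_mult_div)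
  then have "int p ^ N dvd (a * u - int m) * b" by simp
  moreover have "(a * u - int m) * b = a - int m * b - a * w * int p ^ N"
  proof -
    have "a * u * b = a - a * w * int p ^ N"
      using arg_cong[OF uw, of "(*) a"] by (simp add: algebra_simps)
    then show ?thesis by (simp add: algebra_simps)
  qed
  ultimately have "int p ^ N dvd a - int m * b"
    by (metis diff_add_cancel dvd_add dvd_triv_right)
  then obtain c where c: "a - int m * b = int p ^ N * c" by blast
  have "v (of_int (a - int m * b)) \<le> (1 / real p) ^ N"
    unfolding c using mult_left_mono[OF v_of_int_le_1[of c], of "(1 / real p) ^ N"]
    by (simp add: v_mult v_power v_p)
  moreover have "s - of_nat m = of_int (a - int m * b) / of_int b"
    using ab by (simp add: field_simps)
  ultimately have "v (s - of_nat m) < e" using vb N by (simp add: v_divide)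
  then show ?thesis
    using v_ultrametric[of "x - s" "s - of_nat m"] s(2) by (intro exI[of _ m]) auto
qed

lemma Zp_nat_sequence:
  assumes "x \<in> Zp v"
  obtains a where "v_tendsto v (\<lambda>n. of_nat (a n)) x"
proof -
  obtain a where a: "\<And>n. v (x - of_nat (a n)) < 1 / real (Suc n)"
    using choice[of "\<lambda>n m. v (x - of_nat m) < 1 / real (Suc n)"] Zp_nat_approx[OF assms] by auto
  have "v_tendsto v (\<lambda>n. of_nat (a n)) x"
    by (rule v_tendsto_squeeze[OF _ LIMSEQ_inverse_real_of_nat])
      (use a in \<open>simp add: v_minus_commute inverse_eq_divide less_imp_le\<close>)
  then show ?thesis by (rule that)
qed

lemma nat_sequence_Zp:
  assumes "v_tendsto v (\<lambda>n. of_nat (a n)) x"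
  shows "x \<in> Zp v"
proof -
  have "\<exists>s\<in>\<rat>. v (x - s) < e" if "0 < e" for e
    using v_tendstoD[OF assms that] v_minus_commute by (metis Rats_of_nat order_refl)
  moreover have "v x \<le> 1"
    using v_tendsto_le[OF assms] v_of_nat_le_1 by blast
  ultimately show ?thesis by (simp add: Zp_def Qp_def v_closure_def)
qed

lemma of_nat_Zp: "of_nat m \<in> Zp v"
  using nat_sequence_Zp[OF v_tendsto_const] .

lemma Zp_diff:
  assumes "x \<in> Zp v" and "y \<in> Zp v"
  shows "x - y \<in> Zp v"
proof -
  have "\<exists>s\<in>\<rat>. v (x - y - s) < e" if e: "0 < e" for e
  proof -
    obtain m n where "v (x - of_nat m) < e" "v (y - of_nat n) < e"
      using Zp_nat_approx[OF _ e] assms by metis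
    then have "v (x - y - (of_nat m - of_nat n)) < e"
      using v_diff_ultrametric[of "x - of_nat m" "y - of_nat n"] by (simp add: algebra_simps)
    then show ?thesis by (meson Rats_diff Rats_of_nat)
  qed
  moreover have "v (x - y) \<le> 1" using assms by (auto simp: Zp_def intro: v_diff_le)
  ultimately show ?thesis by (simp add: Zp_def Qp_def v_closure_def)
qed

subsection \<open>Powers with \<open>p\<close>-adic exponents\<close>

lemma v_eq_1_of_near_1: "v (1 - r) < 1 \<Longrightarrow> v r = 1"
  using v_diff_ultrametric[of 1 "1 - r"] v_ultrametric[of r "1 - r"] by auto

text \<open>In the binomial expansion every middle coefficient is divisible by \<open>p\<close>,
  which contributes the factor \<open>1 / p\<close>; the last term contributes
  \<open>v w ^ p\<close>.\<close>

lemma v_prime_power_minus_1_le: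
  "v ((1 + w) ^ p - 1) \<le> max (1 / real p) (v w ^ (p - 1)) * v w"
proof -
  have p: "p = Suc (p - 1)" using prime_gt_0_nat[OF prime_p] by simp
  have "(1 + w) ^ p = (\<Sum>i\<le>p. of_nat (p choose i) * w ^ i)"
    using binomial_ring[of w 1 p] by (simp add: add.commute)
  also have "\<dots> = 1 + (\<Sum>i=1..p. of_nat (p choose i) * w ^ i)"
    by (simp add: atMost_atLeast0 sum.atLeast_Suc_atMost)
  finally have "(1 + w) ^ p - 1 = (\<Sum>i=1..p. of_nat (p choose i) * w ^ i)" by simp
  also have "v \<dots> \<le> max (1 / real p) (v w ^ (p - 1)) * v w"
  proof (rule v_sum_le)
    fix i assume i: "i \<in> {1..p}"
    show "v (of_nat (p choose i) * w ^ i) \<le> max (1 / real p) (v w ^ (p - 1)) * v w"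
    proof (cases "i = p")
      case True
      have "v w ^ p = v w ^ (p - 1) * v w" by (subst p) simp
      then show ?thesis using True by (simp add: v_power v_nonneg mult_right_mono)
    next
      case False
      then have "p dvd (p choose i)" using i prime_p by (intro dvd_choose_prime) auto
      then obtain c where "(p choose i) = p * c" by blast
      then have "v (of_nat (p choose i) * w ^ i) = (1 / real p * v w ^ i) * v (of_nat c)"
        by (simp add: v_mult v_power v_p)
      also have "\<dots> \<le> 1 / real p * v w ^ i"
        using mult_left_mono[OF v_of_nat_le_1[of c], of "1 / real p * v w ^ i"] by (simp add: v_nonneg)
      finally have le: "v (of_nat (p choose i) * w ^ i) \<le> 1 / real p * v w ^ i" .
      obtain j where j: "i = Suc j" "j \<le> p - 1" using i by (cases i) auto
      show ?thesis
      proof (cases "v w \<le> 1")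
        case True
        then have "v w ^ i \<le> v w" using j power_le_one[OF v_nonneg True, of j] v_nonneg[of w]
          by (simp add: mult_left_le)
        then have "1 / real p * v w ^ i \<le> 1 / real p * v w"
          by (intro mult_left_mono) auto
        also have "\<dots> \<le> max (1 / real p) (v w ^ (p - 1)) * v w"
          by (intro mult_right_mono) (simp_all add: v_nonneg)
        finally show ?thesis using le by linarith
      next
        \<comment> \<open>For \<open>v w > 1\<close> the powers grow with the exponent, so
          \<open>v w ^ p\<close> dominates the middle terms.\<close>
        case w: False
        have "1 / real p * v w ^ i \<le> 1 * v w ^ i"
          using p_gt_1 by (intro mult_right_mono) (simp_all add: v_nonneg)
        also have "\<dots> = v w ^ j * v w" by (simp add: j)
        also have "\<dots> \<le> v w ^ (p - 1) * v w"
          using w j by (intro mult_right_mono power_increasing) (simp_all add: v_nonneg)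
        also have "\<dots> \<le> max (1 / real p) (v w ^ (p - 1)) * v w"
          by (intro mult_right_mono) (simp_all add: v_nonneg)
        finally show ?thesis using le by linarith
      qed
    qed
  qed (simp add: v_nonneg le_max_iff_disj)
  finally show ?thesis .
qed

text \<open>Each further \<open>p\<close>-th power shrinks the distance to 1 by at least the fixed
  factor \<open>c < 1\<close>, so the decay is geometric.\<close>

lemma p_power_power_tendsto_1:
  assumes "v (1 - r) < 1"
  shows "(\<lambda>M. v (r ^ (p ^ M) - 1)) \<longlonglongrightarrow> 0"
proof -
  define c where "c = max (1 / real p) (v (r - 1))"
  have c: "0 \<le> c" "c < 1"
    using p_gt_1 assms by (auto simp: c_def v_minus_commute[of r] le_max_iff_disj)
  have bound: "v (r ^ (p ^ M) - 1) \<le> c ^ Suc M" for M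
  proof (induction M)
    case (Suc M)
    define w where "w = r ^ (p ^ M) - 1"
    have "v w \<le> c ^ Suc M" using Suc by (simp add: w_def)
    also have "\<dots> \<le> c" using c by (simp add: mult_left_le power_le_one)
    finally have wc: "v w \<le> c" .
    \<comment> \<open>Since \<open>p - 1\<close> is at least 1 and \<open>v w < 1\<close>, the
      factor \<open>v w ^ (p - 1)\<close> is at most \<open>v w\<close>, hence at most
      \<open>c\<close>.\<close>
    obtain j where j: "p - 1 = Suc j" using prime_gt_1_nat[OF prime_p] by (cases "p - 1") auto
    have "v w ^ (p - 1) \<le> v w"
      using power_le_one[OF v_nonneg, of w j] wc c v_nonneg[of w] unfolding j by (simp add: mult_left_le)
    then have "max (1 / real p) (v w ^ (p - 1)) \<le> c" using wc by (auto simp: c_def)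
    then have "max (1 / real p) (v w ^ (p - 1)) * v w \<le> c * c ^ Suc M"
      using Suc c by (intro mult_mono) (simp_all add: w_def v_nonneg)
    then show ?case
      using v_prime_power_minus_1_le[of w] by (simp add: w_def power_mult[symmetric] mult.commute)
  qed (simp add: c_def)
  show ?thesis
    by (rule tendsto_sandwich[OF _ _ tendsto_const LIMSEQ_Suc[OF LIMSEQ_realpow_zero[OF c]]])
      (use bound in \<open>simp_all add: v_nonneg\<close>)
qed

text \<open>\<open>u - 1\<close> divides \<open>u ^ m - 1\<close>, and the cofactor is a geometric
  sum of absolute value at most 1.\<close>

lemma v_power_minus_1_le:
  assumes "v u \<le> 1"
  shows "v (u ^ m - 1) \<le> v (u - 1)"
proof -
  have "v (\<Sum>i<m. u ^ i) \<le> 1"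
    using assms by (intro v_sum_le) (auto simp: v_power v_nonneg power_le_one)
  then have "v (u - 1) * v (\<Sum>i<m. u ^ i) \<le> v (u - 1)"
    using mult_left_mono[OF _ v_nonneg] by fastforce
  then show ?thesis by (simp add: power_diff_1_eq v_mult)
qed

lemma power_uniformly_continuous_at_0:
  assumes "v (1 - r) < 1" and "0 < e"
  obtains d where "0 < d" and "\<And>m. v (of_nat m) < d \<Longrightarrow> v (r ^ m - 1) < e"
proof -
  obtain M where M: "v (r ^ (p ^ M) - 1) < e"
    using LIMSEQ_D[OF p_power_power_tendsto_1[OF assms(1)] assms(2)] by (auto simp: v_nonneg)
  show thesis
  proof (rule that)
    show "0 < (1 / real p) ^ M" using p_gt_1 by simp
    fix m assume "v (of_nat m) < (1 / real p) ^ M"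
    then obtain c where c: "m = p ^ M * c"
      using p_power_dvd_of_v_le[of m M] by auto
    have "v (r ^ m - 1) \<le> v (r ^ (p ^ M) - 1)"
      unfolding c power_mult
      by (rule v_power_minus_1_le) (simp add: v_power v_eq_1_of_near_1[OF assms(1)])
    then show "v (r ^ m - 1) < e" using M by simp
  qed
qed

text \<open>Pulling out the smaller power, which has absolute value 1, reduces continuity everywhere
  to continuity at the exponent 0.\<close>

lemma power_uniformly_continuous:
  assumes "v (1 - r) < 1" and "0 < e"
  obtains d where "0 < d" and "\<And>m n. v (of_nat m - of_nat n) < d \<Longrightarrow> v (r ^ m - r ^ n) < e"
proof -
  obtain d where d: "0 < d" "\<And>m. v (of_nat m) < d \<Longrightarrow> v (r ^ m - 1) < e"
    using power_uniformly_continuous_at_0[OF assms] by metis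
  have *: "v (r ^ m - r ^ n) < e" if "v (of_nat m - of_nat n) < d" "n \<le> m" for m n
  proof -
    have "r ^ m - r ^ n = r ^ n * (r ^ (m - n) - 1)"
      using that(2) by (simp add: algebra_simps flip: power_add)
    then have "v (r ^ m - r ^ n) = v (r ^ (m - n) - 1)"
      by (simp add: v_mult v_power v_eq_1_of_near_1[OF assms(1)])
    then show ?thesis using d(2)[of "m - n"] that by (simp add: of_nat_diff)
  qed
  show thesis
  proof (rule that[OF d(1)])
    fix m n assume "v (of_nat m - of_nat n) < d"
    then show "v (r ^ m - r ^ n) < e"
      using *[of m n] *[of n m] v_minus_commute by (metis nat_le_linear)
  qed
qed

text \<open>Justifies the \<open>THE\<close> in \<open>v_pow\<close>: uniform continuity makes the
  powers Cauchy, and any two sequences approximating \<open>y\<close> give the same limit. The given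
  sequence \<open>a\<close> keeps the defining condition from being vacuous, so the limit is
  unique.\<close>

lemma v_pow_tendsto:
  assumes r: "v (1 - r) < 1" and a: "v_tendsto v (\<lambda>n. of_nat (a n)) y"
  shows "v_tendsto v (\<lambda>n. r ^ a n) (v_pow v r y)"
proof -
  have "v_cauchy v (\<lambda>n. r ^ a n)"
    unfolding v_cauchy_def
  proof (intro allI impI)
    fix e :: real assume "0 < e"
    then obtain d where d: "0 < d" "\<And>m n. v (of_nat m - of_nat n) < d \<Longrightarrow> v (r ^ m - r ^ n) < e"
      using power_uniformly_continuous[OF r] by metis
    then show "\<exists>M. \<forall>m\<ge>M. \<forall>n\<ge>M. v (r ^ a m - r ^ a n) < e"
      using v_tendsto_cauchy[OF a] unfolding v_cauchy_def by meson
  qed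
  then obtain l where l: "v_tendsto v (\<lambda>n. r ^ a n) l" using v_complete by blast
  have "v_tendsto v (\<lambda>n. r ^ b n) l" if b: "v_tendsto v (\<lambda>n. of_nat (b n)) y" for b
  proof -
    have "v_tendsto v (\<lambda>n. of_nat (b n) - of_nat (a n)) (y - y)"
      by (rule v_tendsto_diff[OF b a])
    then have ba: "v_tendsto v (\<lambda>n. of_nat (b n) - of_nat (a n)) 0" by simp
    have "v_tendsto v (\<lambda>n. r ^ b n - r ^ a n) 0"
    proof (rule v_tendstoI)
      fix e :: real assume "0 < e"
      then obtain d where d: "0 < d" "\<And>m n. v (of_nat m - of_nat n) < d \<Longrightarrow> v (r ^ m - r ^ n) < e"
        using power_uniformly_continuous[OF r] by metis
      then show "\<exists>N. \<forall>n\<ge>N. v (r ^ b n - r ^ a n - 0) < e"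
        using v_tendstoD[OF ba d(1)] by auto
    qed
    from v_tendsto_add[OF this l] show ?thesis by simp
  qed
  then have "v_pow v r y = l"
    unfolding v_pow_def using a l v_tendsto_unique by (intro the_equality) blast+
  then show ?thesis using l by simp
qed

lemma v_pow_of_nat:
  assumes "v (1 - r) < 1"
  shows "v_pow v r (of_nat m) = r ^ m"
  using v_tendsto_unique[OF v_pow_tendsto[OF assms v_tendsto_const] v_tendsto_const] .

lemma v_pow_add:
  assumes "v (1 - r) < 1" and "x \<in> Zp v" and "y \<in> Zp v"
  shows "v_pow v r (x + y) = v_pow v r x * v_pow v r y"
proof -
  obtain a b where ab: "v_tendsto v (\<lambda>n. of_nat (a n)) x" "v_tendsto v (\<lambda>n. of_nat (b n)) y"
    using Zp_nat_sequence assms(2,3) by metis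
  have "v_tendsto v (\<lambda>n. r ^ (a n + b n)) (v_pow v r (x + y))"
    using v_tendsto_add[OF ab] by (intro v_pow_tendsto[OF assms(1)]) simp
  moreover have "v_tendsto v (\<lambda>n. r ^ (a n + b n)) (v_pow v r x * v_pow v r y)"
    unfolding power_add by (intro v_tendsto_mult v_pow_tendsto assms ab)
  ultimately show ?thesis by (rule v_tendsto_unique)
qed

section \<open>Powers with inverse base and the reflection formula\<close>

lemma near_1_inverse:
  assumes "v (1 - q) < 1"
  shows "v (1 - 1 / q) < 1"
proof -
  have q: "v q = 1" using v_eq_1_of_near_1[OF assms] .
  then have "q \<noteq> 0" by auto
  then have "1 - 1 / q = (q - 1) / q" by (simp add: field_simps)
  then show ?thesis using assms q by (simp add: v_divide v_minus_commute)
qed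

lemma v_pow_inverse:
  assumes "v (1 - q) < 1" and "x \<in> Zp v"
  shows "v_pow v (1 / q) x * v_pow v q x = 1"
proof -
  obtain a where a: "v_tendsto v (\<lambda>n. of_nat (a n)) x"
    using Zp_nat_sequence assms(2) by metis
  have "q \<noteq> 0" using v_eq_1_of_near_1[OF assms(1)] by auto
  have "v_tendsto v (\<lambda>n. (1 / q) ^ a n * q ^ a n) (v_pow v (1 / q) x * v_pow v q x)"
    by (intro v_tendsto_mult v_pow_tendsto near_1_inverse assms a)
  moreover have "(\<lambda>n. (1 / q) ^ a n * q ^ a n) = (\<lambda>_. 1)"
    using \<open>q \<noteq> 0\<close> by (simp add: power_one_over)
  ultimately show ?thesis using v_tendsto_unique v_tendsto_const by metis
qed

text \<open>The identities \<open>q^(1-x) * q^x = q\<close> and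
  \<open>(1/q)^(1-x) * q^(1-x) = 1\<close> give \<open>(1/q)^(1-x) = q^x / q\<close>. Substituting
  this leaves an identity of rational expressions in \<open>q\<close> and
  \<open>q^x\<close>.\<close>

lemma q_number_reflection:
  assumes "v (1 - q) < 1" and "x \<in> Zp v"
  shows "q_number v (1 / q) (1 - x) = 1 - q_number v q x"
proof (cases "q = 1")
  case False
  have "q \<noteq> 0" using v_eq_1_of_near_1[OF assms(1)] by auto
  have x1: "1 - x \<in> Zp v" using Zp_diff[OF of_nat_Zp[of 1] assms(2)] by simp
  have "v_pow v q (1 - x) * v_pow v q x = q"
    using v_pow_add[OF assms(1) x1 assms(2)] v_pow_of_nat[OF assms(1), of 1] by simp
  moreover have "v_pow v (1 / q) (1 - x) * v_pow v q (1 - x) = 1"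
    by (rule v_pow_inverse[OF assms(1) x1])
  ultimately have "v_pow v (1 / q) (1 - x) * q = v_pow v q x"
    by (metis mult.assoc mult.left_neutral)
  then have e: "v_pow v (1 / q) (1 - x) = v_pow v q x / q"
    using \<open>q \<noteq> 0\<close> by (simp add: field_simps)
  have "1 / q \<noteq> 1" using False \<open>q \<noteq> 0\<close> by (simp add: field_simps)
  moreover have "1 - q \<noteq> 0" "q - 1 \<noteq> 0" using False by auto
  ultimately show ?thesis
    using False \<open>q \<noteq> 0\<close> unfolding q_number_def e by (simp add: divide_simps) (simp add: algebra_simps)
qed (simp add: q_number_def)

subsection \<open>Differentiability of the power function\<close>

text \<open>The factor \<open>v (of_nat m)\<close>, which later allows division by \<open>m\<close>,
  comes from \<open>i * (m choose i) = m * ((m - 1) choose (i - 1))\<close>. Dividing by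
  \<open>i\<close> costs at most a factor \<open>i\<close>, and the smallness of \<open>w\<close>
  absorbs it.\<close>

lemma v_power_linear_approx:
  assumes "v w \<le> 1 / 4"
  shows "v ((1 + w) ^ m - 1 - of_nat m * w) \<le> 2 * v (of_nat m) * (v w)\<^sup>2"
proof -
  have "(1 + w) ^ m - 1 - of_nat m * w = (\<Sum>i=2..m. of_nat (m choose i) * w ^ i)"
  proof (cases "m = 0")
    case False
    have "(1 + w) ^ m = (\<Sum>i\<le>m. of_nat (m choose i) * w ^ i)"
      using binomial_ring[of w 1 m] by (simp add: add.commute)
    also have "\<dots> = 1 + (of_nat m * w + (\<Sum>i=2..m. of_nat (m choose i) * w ^ i))"
      using False by (simp add: atMost_atLeast0 sum.atLeast_Suc_atMost numeral_2_eq_2)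
    finally show ?thesis by simp
  qed simp
  also have "v \<dots> \<le> 2 * v (of_nat m) * (v w)\<^sup>2"
  proof (rule v_sum_le)
    fix i assume "i \<in> {2..m}"
    then obtain j where j: "i = Suc (Suc j)" and i0: "i \<noteq> 0"
      by (cases i; cases "i - 1") auto
    have "i * (m choose i) = m * ((m - 1) choose (i - 1))"
      using i0 by (intro times_binomial_minus1_eq) simp
    then have "v (of_nat i) * v (of_nat (m choose i)) = v (of_nat m) * v (of_nat ((m - 1) choose (i - 1)))"
      by (metis of_nat_mult v_mult)
    also have "\<dots> \<le> v (of_nat m)"
      by (intro mult_left_le v_of_nat_le_1 v_nonneg)
    finally have "v (of_nat i) * v (of_nat (m choose i)) \<le> v (of_nat m)" .
    moreover have vi: "0 < v (of_nat i)"
      using i0 by (intro v_pos) simp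
    ultimately have "v (of_nat (m choose i)) \<le> v (of_nat m) * (1 / v (of_nat i))"
      by (simp add: pos_le_divide_eq mult.commute)
    also have "\<dots> \<le> v (of_nat m) * real i"
      by (intro mult_left_mono inverse_v_of_nat_le i0 v_nonneg)
    finally have "v (of_nat (m choose i) * w ^ i) \<le> v (of_nat m) * real i * v w ^ i"
      unfolding v_mult v_power by (intro mult_right_mono) (simp_all add: v_nonneg)
    also have "\<dots> = v (of_nat m) * (v w)\<^sup>2 * (real i * v w ^ j)"
      by (simp add: j power2_eq_square)
    \<comment> \<open>Here \<open>i = j + 2 \<le> 2 * 2 ^ j\<close>, and the bound
      \<open>1 / 4\<close> on \<open>v w\<close> more than compensates this growth; it is the source
      of the constant 2.\<close>
    also have "real i * v w ^ j \<le> 2"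
    proof -
      have "real i \<le> 2 * 2 ^ j" unfolding j by (induction j) auto
      then have "real i * v w ^ j \<le> (2 * 2 ^ j) * (1 / 4) ^ j"
        using assms by (intro mult_mono power_mono) (simp_all add: v_nonneg)
      also have "\<dots> = 2 * (1 / 2) ^ j" by (simp add: power_mult_distrib[symmetric])
      also have "\<dots> \<le> 2" by (simp add: power_le_one)
      finally show ?thesis .
    qed
    then have "v (of_nat m) * (v w)\<^sup>2 * (real i * v w ^ j) \<le> v (of_nat m) * (v w)\<^sup>2 * 2"
      by (intro mult_left_mono) (simp_all add: v_nonneg)
    finally show "v (of_nat (m choose i) * w ^ i) \<le> 2 * v (of_nat m) * (v w)\<^sup>2" by (simp add: mult_ac)
  qed (simp add: v_nonneg)
  finally show ?thesis .
qed

text \<open>The limit \<open>L\<close> of \<open>(r ^ p ^ M - 1) / p ^ M\<close> is the \<open>p\<close>-adic logarithm of \<open>r\<close>.\<close>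

lemma power_differentiable_at_0:
  assumes r: "v (1 - r) < 1"
  obtains L where "\<And>e. 0 < e \<Longrightarrow>
    \<exists>d>0. \<forall>m. v (of_nat m) < d \<longrightarrow> v (r ^ m - 1 - L * of_nat m) \<le> e * v (of_nat m)"
proof -
  define w where "w M = r ^ (p ^ M) - 1" for M
  define l where "l M = w M / of_nat (p ^ M)" for M
  have p0: "(of_nat (p ^ M) :: 'a) \<noteq> 0" for M using p_gt_1 by simp
  have wl: "w M = of_nat (p ^ M) * l M" for M using p0[of M] by (simp add: l_def)
  have w0: "(\<lambda>M. v (w M)) \<longlonglongrightarrow> 0" unfolding w_def by (rule p_power_power_tendsto_1[OF r])
  then obtain M0 where M0: "\<And>M. M \<ge> M0 \<Longrightarrow> v (w M) < 1 / 4"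
    using LIMSEQ_D[OF w0, of "1 / 4"] by (auto simp: v_nonneg)
  \<comment> \<open>One of the two factors \<open>w M\<close> in the quadratic error is rewritten as
    \<open>p ^ M * l M\<close>, which makes the error relative to the exponent
    \<open>p ^ M * m\<close>.\<close>
  have approx: "v (r ^ (p ^ M * m) - 1 - of_nat (p ^ M * m) * l M)
      \<le> 2 * v (of_nat (p ^ M * m)) * v (w M) * v (l M)" if "M \<ge> M0" for M m
  proof -
    have "v ((1 + w M) ^ m - 1 - of_nat m * w M) \<le> 2 * v (of_nat m) * (v (w M))\<^sup>2"
      using M0[OF that] by (intro v_power_linear_approx) simp
    moreover have "(1 + w M) ^ m = r ^ (p ^ M * m)" by (simp add: w_def power_mult)
    moreover have "of_nat m * w M = of_nat (p ^ M * m) * l M" by (simp add: wl)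
    moreover have "2 * v (of_nat m) * (v (w M))\<^sup>2 = 2 * v (of_nat (p ^ M * m)) * v (w M) * v (l M)"
      by (simp add: power2_eq_square) (simp add: wl v_mult)
    ultimately show ?thesis by simp
  qed
  \<comment> \<open>The case \<open>m = p\<close> of \<open>approx\<close> compares consecutive
    quotients.\<close>
  have l_step: "v (l (Suc M) - l M) \<le> 2 * v (w M) * v (l M)" if "M \<ge> M0" for M
  proof -
    have "r ^ (p ^ M * p) - 1 - of_nat (p ^ M * p) * l M = of_nat (p ^ Suc M) * (l (Suc M) - l M)"
      using wl[of "Suc M"] by (simp add: w_def algebra_simps)
    then have "v (of_nat (p ^ Suc M)) * v (l (Suc M) - l M)
        \<le> v (of_nat (p ^ Suc M)) * (2 * v (w M) * v (l M))"
      using approx[OF that, of p] by (simp add: v_mult mult_ac)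
    moreover have "0 < v (of_nat (p ^ Suc M))" using p_gt_1 by (simp only: v_p_power) simp
    ultimately show ?thesis by (rule mult_left_le_imp_le)
  qed
  define C where "C = v (l M0)"
  \<comment> \<open>Beyond \<open>M0\<close> each step is at most \<open>v (l M)\<close>, so by the
    ultrametric inequality the quotients never exceed the initial bound \<open>C\<close>.\<close>
  have lC: "v (l M) \<le> C" if "M \<ge> M0" for M
    using that
  proof (induction M rule: dec_induct)
    case (step M)
    have "2 * v (w M) * v (l M) \<le> 1 * v (l M)"
      using M0[of M] step(1) by (intro mult_right_mono v_nonneg) simp
    then have "v (l (Suc M) - l M) \<le> C"
      using l_step[of M] step.hyps step.IH by linarith
    then show ?case using v_add_le[of "l (Suc M) - l M" C "l M"] step.IH by simp
  qed (simp add: C_def)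
  have wC: "2 * v (w M) * v (l M) \<le> 2 * C * v (w M)" if "M \<ge> M0" for M
    using mult_left_mono[OF lC[OF that], of "2 * v (w M)"] by (simp add: v_nonneg mult_ac)
  have "(\<lambda>M. v (l (Suc M) - l M)) \<longlonglongrightarrow> 0"
  proof (rule tendsto_sandwich[OF _ _ tendsto_const])
    show "(\<lambda>M. 2 * C * v (w M)) \<longlonglongrightarrow> 0" using tendsto_mult_right_zero[OF w0] by simp
    show "\<forall>\<^sub>F M in sequentially. v (l (Suc M) - l M) \<le> 2 * C * v (w M)"
      using l_step wC by (intro eventually_sequentiallyI[of M0]) force
  qed (simp add: v_nonneg)
  then obtain L where L: "v_tendsto v l L" using v_cauchy_SucI v_complete by blast
  show thesis
  proof (rule that)
    fix e :: real assume e: "0 < e"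
    obtain M1 where M1: "\<And>M. M \<ge> M1 \<Longrightarrow> v (l M - L) < e" using v_tendstoD[OF L e] by blast
    have "(\<lambda>M. 2 * C * v (w M)) \<longlonglongrightarrow> 0" using tendsto_mult_right_zero[OF w0] by simp
    from LIMSEQ_D[OF this e] obtain M2 where M2: "\<And>M. M \<ge> M2 \<Longrightarrow> 2 * C * v (w M) < e"
      by fastforce
    define M where "M = max M0 (max M1 M2)"
    have M: "M \<ge> M0" "M \<ge> M1" "M \<ge> M2" by (auto simp: M_def)
    have "v (r ^ m - 1 - L * of_nat m) \<le> e * v (of_nat m)" if "v (of_nat m) < (1 / real p) ^ M" for m
    proof -
      obtain c where c: "m = p ^ M * c"
        using p_power_dvd_of_v_le[of m M] \<open>v (of_nat m) < (1 / real p) ^ M\<close> by auto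
      \<comment> \<open>First the slope \<open>l M\<close> is used, then it is replaced by
        \<open>L\<close>. By the ultrametric inequality neither error needs to be halved.\<close>
      have "v (r ^ m - 1 - of_nat m * l M) \<le> v (of_nat m) * (2 * v (w M) * v (l M))"
        using approx[OF M(1), of c] unfolding c by (simp add: mult_ac)
      also have "\<dots> \<le> v (of_nat m) * e"
        using wC[OF M(1)] M2[OF M(3)] by (intro mult_left_mono v_nonneg) simp
      finally have 1: "v (r ^ m - 1 - of_nat m * l M) \<le> e * v (of_nat m)" by (simp add: mult.commute)
      have "v (of_nat m * (l M - L)) \<le> v (of_nat m) * e"
        unfolding v_mult using M1[OF M(2)] by (intro mult_left_mono v_nonneg) simp
      then have 2: "v (of_nat m * (l M - L)) \<le> e * v (of_nat m)" by (simp add: mult.commute)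
      show ?thesis using v_add_le[OF 1 2] by (simp add: algebra_simps)
    qed
    then show "\<exists>d>0. \<forall>m. v (of_nat m) < d \<longrightarrow> v (r ^ m - 1 - L * of_nat m) \<le> e * v (of_nat m)"
      using p_gt_1 by (intro exI[of _ "(1 / real p) ^ M"]) simp
  qed
qed

text \<open>
  Strict differentiability on \<open>\<int>\<^sub>p\<close> with bounds on \<open>f\<close> and \<open>f'\<close>: compactness of \<open>\<int>\<^sub>p\<close> would
  provide the bounds, and they make the product rule elementary.
\<close>

definition bounded_strict_derivative :: "('a \<Rightarrow> 'a) \<Rightarrow> ('a \<Rightarrow> 'a) \<Rightarrow> bool" where
  "bounded_strict_derivative f f' \<longleftrightarrow>
    (\<exists>B. \<forall>x\<in>Zp v. v (f x) \<le> B \<and> v (f' x) \<le> B) \<and>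
    (\<forall>e>0. \<exists>d>0. \<forall>x\<in>Zp v. \<forall>y\<in>Zp v.
       v (x - y) < d \<longrightarrow> v (f x - f y - f' x * (x - y)) \<le> e * v (x - y))"

section \<open>Calculus of bounded strict derivatives\<close>

lemma bounded_strict_derivativeE:
  assumes "bounded_strict_derivative f f'"
  obtains B where "0 < B" and "\<And>x. x \<in> Zp v \<Longrightarrow> v (f x) \<le> B" and "\<And>x. x \<in> Zp v \<Longrightarrow> v (f' x) \<le> B"
proof -
  obtain B where "\<forall>x\<in>Zp v. v (f x) \<le> B \<and> v (f' x) \<le> B"
    using assms unfolding bounded_strict_derivative_def by blast
  \<comment> \<open>Enlarging the bound makes it positive, so that the product rule may divide by
    it.\<close>
  then show thesis by (intro that[of "max B 1"]) (auto simp: le_max_iff_disj)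
qed

lemma bounded_strict_derivativeD:
  assumes "bounded_strict_derivative f f'" and "0 < e"
  obtains d where "0 < d" and "\<And>x y. x \<in> Zp v \<Longrightarrow> y \<in> Zp v \<Longrightarrow> v (x - y) < d \<Longrightarrow>
    v (f x - f y - f' x * (x - y)) \<le> e * v (x - y)"
proof -
  have "\<exists>d>0. \<forall>x\<in>Zp v. \<forall>y\<in>Zp v.
       v (x - y) < d \<longrightarrow> v (f x - f y - f' x * (x - y)) \<le> e * v (x - y)"
    using assms unfolding bounded_strict_derivative_def by simp
  then show thesis using that by blast
qed

text \<open>With the derivative bound \<open>B\<close> itself as tolerance, both the linear term and
  the error are at most \<open>B * v (x - y)\<close>. The estimate serves the product rule and the
  existence of integrals.\<close>

lemma bounded_strict_derivative_lipschitz: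
  assumes "bounded_strict_derivative f f'"
  obtains C d where "0 < C" and "0 < d" and "\<And>x y. x \<in> Zp v \<Longrightarrow> y \<in> Zp v \<Longrightarrow> v (x - y) < d \<Longrightarrow>
    v (f x - f y) \<le> C * v (x - y)"
proof -
  obtain B where B: "0 < B" "\<And>x. x \<in> Zp v \<Longrightarrow> v (f' x) \<le> B"
    using bounded_strict_derivativeE[OF assms] by metis
  obtain d where d: "0 < d" "\<And>x y. x \<in> Zp v \<Longrightarrow> y \<in> Zp v \<Longrightarrow> v (x - y) < d \<Longrightarrow>
    v (f x - f y - f' x * (x - y)) \<le> B * v (x - y)"
    using bounded_strict_derivativeD[OF assms B(1)] by metis
  have "v (f x - f y) \<le> B * v (x - y)" if "x \<in> Zp v" "y \<in> Zp v" "v (x - y) < d" for x y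
  proof -
    have "v (f' x * (x - y)) \<le> B * v (x - y)"
      unfolding v_mult by (intro mult_right_mono v_nonneg B that)
    from v_add_le[OF d(2)[OF that] this] show ?thesis by simp
  qed
  then show thesis using that B(1) d(1) by blast
qed

lemma bounded_strict_derivative_uniformly_differentiable:
  assumes "bounded_strict_derivative f f'"
  shows "uniformly_differentiable v f"
  unfolding uniformly_differentiable_def
proof (intro exI[of _ f'] allI impI)
  fix e :: real assume "0 < e"
  \<comment> \<open>Halving turns the non-strict estimate into the strict one required.\<close>
  then have "0 < e / 2" by simp
  then obtain d where d: "0 < d" "\<And>x y. x \<in> Zp v \<Longrightarrow> y \<in> Zp v \<Longrightarrow> v (x - y) < d \<Longrightarrow>
    v (f x - f y - f' x * (x - y)) \<le> e / 2 * v (x - y)"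
    using bounded_strict_derivativeD[OF assms] by metis
  have "v ((f x - f y) / (x - y) - f' x) < e"
    if "x \<in> Zp v" "y \<in> Zp v" "x \<noteq> y" "v (x - y) < d" for x y
  proof -
    have "0 < v (x - y)" using that(3) by (intro v_pos) simp
    moreover have "(f x - f y) / (x - y) - f' x = (f x - f y - f' x * (x - y)) / (x - y)"
      using that(3) by (simp add: field_simps)
    ultimately have "v ((f x - f y) / (x - y) - f' x) \<le> e / 2"
      using d(2)[OF that(1,2,4)] by (simp add: v_divide field_simps)
    then show ?thesis using \<open>0 < e\<close> by simp
  qed
  then show "\<exists>d>0. \<forall>x\<in>Zp v. \<forall>y\<in>Zp v.
      x \<noteq> y \<and> v (x - y) < d \<longrightarrow> v ((f x - f y) / (x - y) - f' x) < e"
    using d(1) by blast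
qed

lemma bounded_strict_derivative_const: "bounded_strict_derivative (\<lambda>_. c) (\<lambda>_. 0)"
  unfolding bounded_strict_derivative_def by (auto simp: v_nonneg intro: gt_ex)

lemma bounded_strict_derivative_ident: "bounded_strict_derivative (\<lambda>x. x) (\<lambda>_. 1)"
  unfolding bounded_strict_derivative_def using v_nonneg
  by (auto simp: Zp_def intro!: exI[of _ "1 :: real"])

lemma bounded_strict_derivative_add:
  assumes f: "bounded_strict_derivative f f'" and g: "bounded_strict_derivative g g'"
  shows "bounded_strict_derivative (\<lambda>x. f x + g x) (\<lambda>x. f' x + g' x)"
proof -
  obtain B where B: "0 < B" "\<And>x. x \<in> Zp v \<Longrightarrow> v (f x) \<le> B" "\<And>x. x \<in> Zp v \<Longrightarrow> v (f' x) \<le> B"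
    using bounded_strict_derivativeE[OF f] by metis
  obtain D where D: "0 < D" "\<And>x. x \<in> Zp v \<Longrightarrow> v (g x) \<le> D" "\<And>x. x \<in> Zp v \<Longrightarrow> v (g' x) \<le> D"
    using bounded_strict_derivativeE[OF g] by metis
  have "v (f x + g x) \<le> max B D \<and> v (f' x + g' x) \<le> max B D" if "x \<in> Zp v" for x
    using B D that by (intro conjI v_add_le) (simp_all add: le_max_iff_disj)
  moreover have "\<exists>d>0. \<forall>x\<in>Zp v. \<forall>y\<in>Zp v. v (x - y) < d \<longrightarrow>
      v (f x + g x - (f y + g y) - (f' x + g' x) * (x - y)) \<le> e * v (x - y)" if "0 < e" for e
  proof -
    obtain d1 where d1: "0 < d1" "\<And>x y. x \<in> Zp v \<Longrightarrow> y \<in> Zp v \<Longrightarrow> v (x - y) < d1 \<Longrightarrow>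
      v (f x - f y - f' x * (x - y)) \<le> e * v (x - y)"
      using bounded_strict_derivativeD[OF f \<open>0 < e\<close>] by metis
    obtain d2 where d2: "0 < d2" "\<And>x y. x \<in> Zp v \<Longrightarrow> y \<in> Zp v \<Longrightarrow> v (x - y) < d2 \<Longrightarrow>
      v (g x - g y - g' x * (x - y)) \<le> e * v (x - y)"
      using bounded_strict_derivativeD[OF g \<open>0 < e\<close>] by metis
    have "v (f x + g x - (f y + g y) - (f' x + g' x) * (x - y)) \<le> e * v (x - y)"
      if "x \<in> Zp v" "y \<in> Zp v" "v (x - y) < min d1 d2" for x y
    proof -
      have "f x + g x - (f y + g y) - (f' x + g' x) * (x - y) =
          (f x - f y - f' x * (x - y)) + (g x - g y - g' x * (x - y))"
        by (simp add: algebra_simps)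
      also have "v \<dots> \<le> e * v (x - y)"
        using that by (intro v_add_le d1(2) d2(2)) simp_all
      finally show ?thesis .
    qed
    then show ?thesis using d1(1) d2(1) by (intro exI[of _ "min d1 d2"]) simp
  qed
  ultimately show ?thesis unfolding bounded_strict_derivative_def by blast
qed

text \<open>The error splits into \<open>g x\<close> times the error of \<open>f\<close>,
  \<open>f y\<close> times the error of \<open>g\<close>, and the cross term
  \<open>(f x - f y) * g' x * (x - y)\<close>, which the Lipschitz bound makes of second
  order.\<close>

lemma bounded_strict_derivative_mult:
  assumes f: "bounded_strict_derivative f f'" and g: "bounded_strict_derivative g g'"
  shows "bounded_strict_derivative (\<lambda>x. f x * g x) (\<lambda>x. f' x * g x + f x * g' x)"
proof -
  obtain B where B: "0 < B" "\<And>x. x \<in> Zp v \<Longrightarrow> v (f x) \<le> B" "\<And>x. x \<in> Zp v \<Longrightarrow> v (f' x) \<le> B"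
    using bounded_strict_derivativeE[OF f] by metis
  obtain D where D: "0 < D" "\<And>x. x \<in> Zp v \<Longrightarrow> v (g x) \<le> D" "\<And>x. x \<in> Zp v \<Longrightarrow> v (g' x) \<le> D"
    using bounded_strict_derivativeE[OF g] by metis
  have "v (f x * g x) \<le> B * D" if "x \<in> Zp v" for x
    unfolding v_mult using B D that by (intro mult_mono) (auto simp: v_nonneg less_imp_le)
  moreover have "v (f' x * g x + f x * g' x) \<le> B * D" if "x \<in> Zp v" for x
    by (rule v_add_le; unfold v_mult)
      (use B D that in \<open>auto intro!: mult_mono simp: v_nonneg less_imp_le\<close>)
  moreover have "\<exists>d>0. \<forall>x\<in>Zp v. \<forall>y\<in>Zp v. v (x - y) < d \<longrightarrow>
      v (f x * g x - f y * g y - (f' x * g x + f x * g' x) * (x - y)) \<le> e * v (x - y)"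
    if e: "0 < e" for e
  proof -
    obtain d1 where d1: "0 < d1" "\<And>x y. x \<in> Zp v \<Longrightarrow> y \<in> Zp v \<Longrightarrow> v (x - y) < d1 \<Longrightarrow>
      v (f x - f y - f' x * (x - y)) \<le> e / D * v (x - y)"
      using bounded_strict_derivativeD[OF f, of "e / D"] e D(1) by (metis divide_pos_pos)
    obtain d2 where d2: "0 < d2" "\<And>x y. x \<in> Zp v \<Longrightarrow> y \<in> Zp v \<Longrightarrow> v (x - y) < d2 \<Longrightarrow>
      v (g x - g y - g' x * (x - y)) \<le> e / B * v (x - y)"
      using bounded_strict_derivativeD[OF g, of "e / B"] e B(1) by (metis divide_pos_pos)
    obtain C d3 where d3: "0 < C" "0 < d3" "\<And>x y. x \<in> Zp v \<Longrightarrow> y \<in> Zp v \<Longrightarrow> v (x - y) < d3 \<Longrightarrow>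
      v (f x - f y) \<le> C * v (x - y)"
      using bounded_strict_derivative_lipschitz[OF f] by metis
    \<comment> \<open>The radius \<open>e / (C * D)\<close> makes
      \<open>v (f x - f y) * v (g' x)\<close> at most \<open>e\<close> in the cross term.\<close>
    define d where "d = min (min d1 d2) (min d3 (e / (C * D)))"
    have "v (f x * g x - f y * g y - (f' x * g x + f x * g' x) * (x - y)) \<le> e * v (x - y)"
      if x: "x \<in> Zp v" and y: "y \<in> Zp v" and xy: "v (x - y) < d" for x y
    proof -
      have "v (g x) * v (f x - f y - f' x * (x - y)) \<le> D * (e / D * v (x - y))"
        using x y xy D d1(2)[OF x y] by (intro mult_mono) (auto simp: v_nonneg d_def less_imp_le)
      then have 1: "v (g x * (f x - f y - f' x * (x - y))) \<le> e * v (x - y)"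
        using D(1) by (simp add: v_mult)
      have "v (f y) * v (g x - g y - g' x * (x - y)) \<le> B * (e / B * v (x - y))"
        using x y xy B d2(2)[OF x y] by (intro mult_mono) (auto simp: v_nonneg d_def less_imp_le)
      then have 2: "v (f y * (g x - g y - g' x * (x - y))) \<le> e * v (x - y)"
        using B(1) by (simp add: v_mult)
      have "v (f x - f y) \<le> C * v (x - y)" using d3(3)[OF x y] xy by (simp add: d_def)
      also have "\<dots> \<le> C * (e / (C * D))" using xy d3(1) by (intro mult_left_mono) (auto simp: d_def)
      also have "\<dots> = e / D" using d3(1) by simp
      finally have "v (f x - f y) * v (g' x) \<le> e / D * D"
        using D x e by (intro mult_mono) (auto simp: v_nonneg)
      then have "v (f x - f y) * v (g' x) * v (x - y) \<le> e * v (x - y)"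
        using D(1) by (intro mult_right_mono v_nonneg) simp
      then have 3: "v ((f x - f y) * g' x * (x - y)) \<le> e * v (x - y)" by (simp add: v_mult)
      have "f x * g x - f y * g y - (f' x * g x + f x * g' x) * (x - y) =
          g x * (f x - f y - f' x * (x - y)) + f y * (g x - g y - g' x * (x - y))
          - (f x - f y) * g' x * (x - y)"
        by (simp add: algebra_simps)
      then show ?thesis using v_diff_le[OF v_add_le[OF 1 2] 3] by simp
    qed
    moreover have "0 < d" using d1 d2 d3 e D(1) by (simp add: d_def)
    ultimately show ?thesis by blast
  qed
  ultimately show ?thesis unfolding bounded_strict_derivative_def by blast
qed

lemma bounded_strict_derivative_power:
  "bounded_strict_derivative f f' \<Longrightarrow> \<exists>h. bounded_strict_derivative (\<lambda>x. f x ^ m) h"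
proof (induction m)
  case 0
  then show ?case using bounded_strict_derivative_const[of 1] by auto
next
  case (Suc m)
  then show ?case using bounded_strict_derivative_mult[of f f'] by auto
qed

section \<open>Strict differentiability of \<open>q^x\<close> and of \<open>[x]_q\<close>\<close>

lemma v_v_pow_le_1:
  assumes "v (1 - r) < 1" and "x \<in> Zp v"
  shows "v (v_pow v r x) \<le> 1"
proof -
  obtain a where a: "v_tendsto v (\<lambda>n. of_nat (a n)) x" using Zp_nat_sequence[OF assms(2)] .
  show ?thesis
    using v_tendsto_le[OF v_pow_tendsto[OF assms(1) a], of 0 1]
    by (simp add: v_power v_eq_1_of_near_1[OF assms(1)])
qed

text \<open>The estimate for natural exponents is non-strict, so it passes to the limit along
  naturals tending to \<open>h\<close>.\<close>

lemma v_pow_differentiable_at_0: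
  assumes r: "v (1 - r) < 1"
  obtains L where "\<And>e. 0 < e \<Longrightarrow>
    \<exists>d>0. \<forall>h\<in>Zp v. v h < d \<longrightarrow> v (v_pow v r h - 1 - L * h) \<le> e * v h"
proof -
  obtain L where L: "\<And>e. 0 < e \<Longrightarrow>
    \<exists>d>0. \<forall>m. v (of_nat m) < d \<longrightarrow> v (r ^ m - 1 - L * of_nat m) \<le> e * v (of_nat m)"
    using power_differentiable_at_0[OF r] by blast
  show thesis
  proof (rule that)
    fix e :: real assume "0 < e"
    then obtain d where d: "0 < d"
      "\<And>m. v (of_nat m) < d \<Longrightarrow> v (r ^ m - 1 - L * of_nat m) \<le> e * v (of_nat m)"
      using L by metis
    have "v (v_pow v r h - 1 - L * h) \<le> e * v h" if h: "h \<in> Zp v" "v h < d" for h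
    proof -
      obtain a where a: "v_tendsto v (\<lambda>n. of_nat (a n)) h" using Zp_nat_sequence[OF h(1)] .
      have 1: "(\<lambda>n. v (r ^ a n - 1 - L * of_nat (a n))) \<longlonglongrightarrow> v (v_pow v r h - 1 - L * h)"
        by (intro v_tendsto_norm v_tendsto_diff v_tendsto_mult v_pow_tendsto r a v_tendsto_const)
      have 2: "(\<lambda>n. e * v (of_nat (a n))) \<longlonglongrightarrow> e * v h"
        by (intro tendsto_mult tendsto_const v_tendsto_norm a)
      have "\<forall>\<^sub>F n in sequentially. v (of_nat (a n)) < d"
        using order_tendstoD(2)[OF v_tendsto_norm[OF a] h(2)] .
      then have "\<forall>\<^sub>F n in sequentially. v (r ^ a n - 1 - L * of_nat (a n)) \<le> e * v (of_nat (a n))"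
        by eventually_elim (rule d(2))
      with 2 1 show ?thesis by (intro tendsto_le[OF sequentially_bot])
    qed
    then show "\<exists>d>0. \<forall>h\<in>Zp v. v h < d \<longrightarrow> v (v_pow v r h - 1 - L * h) \<le> e * v h"
      using d(1) by blast
  qed
qed

text \<open>Multiplicativity moves the estimate at 0 to any point: factoring out the value at
  \<open>x\<close>, of absolute value at most 1, leaves the increment \<open>y - x\<close>.\<close>

lemma bounded_strict_derivative_v_pow:
  assumes r: "v (1 - r) < 1"
  obtains L where "bounded_strict_derivative (v_pow v r) (\<lambda>x. v_pow v r x * L)"
proof -
  obtain L where L: "\<And>e. 0 < e \<Longrightarrow>
    \<exists>d>0. \<forall>h\<in>Zp v. v h < d \<longrightarrow> v (v_pow v r h - 1 - L * h) \<le> e * v h"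
    using v_pow_differentiable_at_0[OF r] by blast
  have "v (v_pow v r x) \<le> max 1 (v L) \<and> v (v_pow v r x * L) \<le> max 1 (v L)" if "x \<in> Zp v" for x
    using v_v_pow_le_1[OF r that] mult_right_mono[OF v_v_pow_le_1[OF r that] v_nonneg[of L]]
    by (auto simp: v_mult le_max_iff_disj)
  moreover have "\<exists>d>0. \<forall>x\<in>Zp v. \<forall>y\<in>Zp v. v (x - y) < d \<longrightarrow>
      v (v_pow v r x - v_pow v r y - v_pow v r x * L * (x - y)) \<le> e * v (x - y)" if "0 < e" for e
  proof -
    obtain d where d: "0 < d" "\<And>h. h \<in> Zp v \<Longrightarrow> v h < d \<Longrightarrow> v (v_pow v r h - 1 - L * h) \<le> e * v h"
      using L[OF \<open>0 < e\<close>] by blast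
    have "v (v_pow v r x - v_pow v r y - v_pow v r x * L * (x - y)) \<le> e * v (x - y)"
      if x: "x \<in> Zp v" and y: "y \<in> Zp v" and xy: "v (x - y) < d" for x y
    proof -
      have "v_pow v r y = v_pow v r x * v_pow v r (y - x)"
        using v_pow_add[OF r x Zp_diff[OF y x]] by simp
      then have "v_pow v r x - v_pow v r y - v_pow v r x * L * (x - y)
          = - (v_pow v r x * (v_pow v r (y - x) - 1 - L * (y - x)))"
        by (simp add: algebra_simps)
      then have "v (v_pow v r x - v_pow v r y - v_pow v r x * L * (x - y))
          = v (v_pow v r x) * v (v_pow v r (y - x) - 1 - L * (y - x))"
        by (simp only: v_minus v_mult)
      also have "\<dots> \<le> 1 * (e * v (y - x))"
        using d(2)[OF Zp_diff[OF y x]] xy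
        by (intro mult_mono v_v_pow_le_1 r x) (simp_all add: v_nonneg v_minus_commute)
      finally show ?thesis by (simp add: v_minus_commute)
    qed
    then show ?thesis using d(1) by blast
  qed
  ultimately have "bounded_strict_derivative (v_pow v r) (\<lambda>x. v_pow v r x * L)"
    unfolding bounded_strict_derivative_def by blast
  then show thesis by (rule that)
qed

text \<open>For \<open>q = 1\<close> the function is the identity; otherwise it is affine in
  \<open>q^x\<close>.\<close>

lemma bounded_strict_derivative_q_number:
  assumes "v (1 - q) < 1"
  shows "\<exists>h. bounded_strict_derivative (q_number v q) h"
proof (cases "q = 1")
  case True
  then have "q_number v q = (\<lambda>x. x)" by (simp add: fun_eq_iff q_number_def)
  then show ?thesis using bounded_strict_derivative_ident by metis
next
  case False
  obtain L where L: "bounded_strict_derivative (v_pow v q) (\<lambda>x. v_pow v q x * L)"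
    using bounded_strict_derivative_v_pow[OF assms] .
  have "q_number v q = (\<lambda>x. 1 / (1 - q) + (- 1 / (1 - q)) * v_pow v q x)"
    using False by (simp add: fun_eq_iff q_number_def diff_divide_distrib)
  then have "bounded_strict_derivative (q_number v q)
      (\<lambda>x. 0 + (0 * v_pow v q x + (- 1 / (1 - q)) * (v_pow v q x * L)))"
    by (simp only:) (intro bounded_strict_derivative_add bounded_strict_derivative_mult
        bounded_strict_derivative_const L)
  then show ?thesis by blast
qed

subsection \<open>Fermionic integrals\<close>

text \<open>Linearity of the integral starts from \<open>has_fermionic_integral\<close>, which
  carries only uniform differentiability and no bounds, so sums are treated for this notion
  directly.\<close>

lemma uniformly_differentiable_add:
  assumes "uniformly_differentiable v f" and "uniformly_differentiable v g"
  shows "uniformly_differentiable v (\<lambda>x. f x + g x)"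
proof -
  obtain f' where f': "\<forall>e>0. \<exists>d>0. \<forall>x\<in>Zp v. \<forall>y\<in>Zp v.
       x \<noteq> y \<and> v (x - y) < d \<longrightarrow> v ((f x - f y) / (x - y) - f' x) < e"
    using assms(1) unfolding uniformly_differentiable_def by blast
  obtain g' where g': "\<forall>e>0. \<exists>d>0. \<forall>x\<in>Zp v. \<forall>y\<in>Zp v.
       x \<noteq> y \<and> v (x - y) < d \<longrightarrow> v ((g x - g y) / (x - y) - g' x) < e"
    using assms(2) unfolding uniformly_differentiable_def by blast
  have "\<exists>d>0. \<forall>x\<in>Zp v. \<forall>y\<in>Zp v. x \<noteq> y \<and> v (x - y) < d \<longrightarrow>
      v ((f x + g x - (f y + g y)) / (x - y) - (f' x + g' x)) < e" if "0 < e" for e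
  proof -
    obtain d1 where d1: "0 < d1" "\<And>x y. x \<in> Zp v \<Longrightarrow> y \<in> Zp v \<Longrightarrow> x \<noteq> y \<Longrightarrow> v (x - y) < d1 \<Longrightarrow>
      v ((f x - f y) / (x - y) - f' x) < e"
      using f'[rule_format, OF \<open>0 < e\<close>] by blast
    obtain d2 where d2: "0 < d2" "\<And>x y. x \<in> Zp v \<Longrightarrow> y \<in> Zp v \<Longrightarrow> x \<noteq> y \<Longrightarrow> v (x - y) < d2 \<Longrightarrow>
      v ((g x - g y) / (x - y) - g' x) < e"
      using g'[rule_format, OF \<open>0 < e\<close>] by blast
    have "v ((f x + g x - (f y + g y)) / (x - y) - (f' x + g' x)) < e"
      if xy: "x \<in> Zp v" "y \<in> Zp v" "x \<noteq> y" "v (x - y) < min d1 d2" for x y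
    proof -
      have "(f x + g x - (f y + g y)) / (x - y) - (f' x + g' x) =
          ((f x - f y) / (x - y) - f' x) + ((g x - g y) / (x - y) - g' x)"
        by (simp add: diff_divide_distrib add_divide_distrib)
      also have "v \<dots> \<le> max (v ((f x - f y) / (x - y) - f' x)) (v ((g x - g y) / (x - y) - g' x))"
        by (rule v_ultrametric)
      also have "\<dots> < e"
        using d1(2)[of x y] d2(2)[of x y] xy by simp
      finally show ?thesis .
    qed
    then show ?thesis using d1(1) d2(1) by (intro exI[of _ "min d1 d2"]) simp
  qed
  then show ?thesis
    unfolding uniformly_differentiable_def by (intro exI[of _ "\<lambda>x. f' x + g' x"]) simp
qed

lemma uniformly_differentiable_cmult:
  assumes "uniformly_differentiable v f"
  shows "uniformly_differentiable v (\<lambda>x. c * f x)"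
proof (cases "c = 0")
  case True
  then show ?thesis
    using bounded_strict_derivative_uniformly_differentiable[OF bounded_strict_derivative_const[of 0]]
    by simp
next
  case False
  obtain f' where f': "\<forall>e>0. \<exists>d>0. \<forall>x\<in>Zp v. \<forall>y\<in>Zp v.
       x \<noteq> y \<and> v (x - y) < d \<longrightarrow> v ((f x - f y) / (x - y) - f' x) < e"
    using assms(1) unfolding uniformly_differentiable_def by blast
  have vc: "0 < v c" using v_pos[OF False] .
  have "\<exists>d>0. \<forall>x\<in>Zp v. \<forall>y\<in>Zp v. x \<noteq> y \<and> v (x - y) < d \<longrightarrow>
      v ((c * f x - c * f y) / (x - y) - c * f' x) < e" if "0 < e" for e
  proof -
    have "v ((c * f x - c * f y) / (x - y) - c * f' x) = v c * v ((f x - f y) / (x - y) - f' x)" for x y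
      by (simp add: v_mult[symmetric] right_diff_distrib)
    moreover have "v c * t < e \<longleftrightarrow> t < e / v c" for t
      using vc by (simp add: field_simps)
    ultimately show ?thesis
      using f'[rule_format, of "e / v c"] \<open>0 < e\<close> vc by simp
  qed
  then show ?thesis
    unfolding uniformly_differentiable_def by (intro exI[of _ "\<lambda>x. c * f' x"]) simp
qed

lemma has_fermionic_integral_zero: "has_fermionic_integral p v (\<lambda>_. 0) 0"
  using bounded_strict_derivative_uniformly_differentiable[OF bounded_strict_derivative_const[of 0]]
  by (simp add: has_fermionic_integral_def v_tendsto_const)

lemma has_fermionic_integral_add:
  assumes "has_fermionic_integral p v f I" and "has_fermionic_integral p v g J"
  shows "has_fermionic_integral p v (\<lambda>x. f x + g x) (I + J)"
  using assms unfolding has_fermionic_integral_def distrib_right sum.distrib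
  by (intro conjI uniformly_differentiable_add v_tendsto_add) simp_all

lemma has_fermionic_integral_cmult:
  assumes "has_fermionic_integral p v f I"
  shows "has_fermionic_integral p v (\<lambda>x. c * f x) (c * I)"
  using assms unfolding has_fermionic_integral_def mult.assoc sum_distrib_left[symmetric]
  by (intro conjI uniformly_differentiable_cmult v_tendsto_mult v_tendsto_const) simp_all

lemma has_fermionic_integral_sum:
  assumes "\<And>i. i \<in> A \<Longrightarrow> has_fermionic_integral p v (f i) (I i)"
  shows "has_fermionic_integral p v (\<lambda>x. \<Sum>i\<in>A. f i x) (\<Sum>i\<in>A. I i)"
  using assms
proof (induction A rule: infinite_finite_induct)
  case (insert i A)
  then show ?case
    using has_fermionic_integral_add[of "f i" "I i" "\<lambda>x. \<Sum>i\<in>A. f i x" "\<Sum>i\<in>A. I i"] by simp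
qed (simp_all add: has_fermionic_integral_zero)

text \<open>Both the differentiability condition and the sums evaluate the function only on
  \<open>Zp v\<close>, which contains the natural numbers. This admits the reflection formula,
  proved only for \<open>p\<close>-adic integers, under the integral.\<close>

lemma has_fermionic_integral_cong:
  assumes "\<And>x. x \<in> Zp v \<Longrightarrow> f x = g x"
  shows "has_fermionic_integral p v f I \<longleftrightarrow> has_fermionic_integral p v g I"
proof -
  have "uniformly_differentiable v f \<longleftrightarrow> uniformly_differentiable v g"
    unfolding uniformly_differentiable_def by (simp add: assms cong: ball_cong)
  then show ?thesis
    unfolding has_fermionic_integral_def by (simp only: assms[OF of_nat_Zp])
qed

lemma fermionic_integral_eqI:
  "has_fermionic_integral p v f I \<Longrightarrow> fermionic_integral p v f = I"
  unfolding fermionic_integral_def has_fermionic_integral_def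
  by (rule the_equality, assumption) (elim conjE, rule v_tendsto_unique)

text \<open>
  Since \<open>p\<close> is odd, \<open>1 = (\<Sum>j<p. (-1) ^ j)\<close>, so the difference of consecutive partial sums is a
  signed sum of increments \<open>f (x + j p\<^sup>N) - f x\<close>, each of which is \<open>O(p\<^sup>-\<^sup>N)\<close>.
\<close>

lemma fermionic_integral_exists:
  assumes "odd p" and f: "bounded_strict_derivative f f'"
  shows "has_fermionic_integral p v f (fermionic_integral p v f)"
proof -
  define S where "S N = (\<Sum>x<p ^ N. f (of_nat x) * (-1) ^ x)" for N
  obtain C d where Cd: "0 < C" "0 < d"
    "\<And>x y. x \<in> Zp v \<Longrightarrow> y \<in> Zp v \<Longrightarrow> v (x - y) < d \<Longrightarrow> v (f x - f y) \<le> C * v (x - y)"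
    using bounded_strict_derivative_lipschitz[OF f] by metis
  have alt: "(\<Sum>j<m. (-1 :: 'a) ^ j) = (if odd m then 1 else 0)" for m
    by (induction m) auto
  have diff: "S (Suc N) - S N = (\<Sum>j<p. \<Sum>x<p ^ N.
      (f (of_nat (x + j * p ^ N)) - f (of_nat x)) * (-1) ^ (x + j))" for N
  proof -
    \<comment> \<open>As \<open>p ^ N\<close> is odd, \<open>j * p ^ N\<close> and \<open>j\<close>
      have the same parity.\<close>
    have sgn: "(-1 :: 'a) ^ (x + j * p ^ N) = (-1) ^ (x + j)" for x j
      using assms(1) by (simp add: minus_one_power_iff)
    have "S (Suc N) = (\<Sum>x<p * p ^ N. f (of_nat x) * (-1) ^ x)" by (simp add: S_def)
    \<comment> \<open>The range is cut into \<open>p\<close> blocks of length \<open>p ^ N\<close>,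
      each then shifted back to the initial block.\<close>
    also have "\<dots> = (\<Sum>j<p. \<Sum>x=j * p ^ N..<j * p ^ N + p ^ N. f (of_nat x) * (-1) ^ x)"
      by (rule sum.nat_group[symmetric])
    also have "\<dots> = (\<Sum>j<p. \<Sum>x<p ^ N. f (of_nat (x + j * p ^ N)) * (-1) ^ (x + j * p ^ N))"
    proof (rule sum.cong[OF refl])
      fix j
      show "(\<Sum>x=j * p ^ N..<j * p ^ N + p ^ N. f (of_nat x) * (-1) ^ x) =
          (\<Sum>x<p ^ N. f (of_nat (x + j * p ^ N)) * (-1) ^ (x + j * p ^ N))"
        using sum.shift_bounds_nat_ivl[of "\<lambda>x. f (of_nat x) * (-1) ^ x" 0 "j * p ^ N" "p ^ N"]
        by (simp add: atLeast0LessThan add.commute)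
    qed
    finally have 1: "S (Suc N) = (\<Sum>j<p. \<Sum>x<p ^ N. f (of_nat (x + j * p ^ N)) * (-1) ^ (x + j))"
      by (simp only: sgn)
    have "S N = (\<Sum>j<p. (-1) ^ j) * S N" using alt[of p] assms(1) by simp
    also have "\<dots> = (\<Sum>j<p. \<Sum>x<p ^ N. f (of_nat x) * (-1) ^ (x + j))"
      by (simp add: S_def sum_product power_add mult_ac)
    finally show ?thesis using 1 by (simp add: sum_subtractf left_diff_distrib)
  qed
  obtain N0 where N0: "(1 / real p) ^ N0 < d"
    using real_arch_pow_inv[OF Cd(2), of "1 / real p"] p_gt_1 by auto
  have bound: "v (S (Suc N) - S N) \<le> C * (1 / real p) ^ N" if "N \<ge> N0" for N
    unfolding diff
  proof (intro v_sum_le)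
    fix j x
    define t where "t = f (of_nat (x + j * p ^ N)) - f (of_nat x)"
    have "v (of_nat (x + j * p ^ N) - of_nat x) = v (of_nat j) * (1 / real p) ^ N"
      by (simp add: v_mult v_power v_p)
    also have "\<dots> \<le> (1 / real p) ^ N"
      using mult_right_mono[OF v_of_nat_le_1[of j], of "(1 / real p) ^ N"] by simp
    finally have le: "v (of_nat (x + j * p ^ N) - of_nat x) \<le> (1 / real p) ^ N" .
    also have "\<dots> \<le> (1 / real p) ^ N0"
      using that p_gt_1 by (intro power_decreasing) auto
    finally have "v (of_nat (x + j * p ^ N) - of_nat x) < d" using N0 by simp
    then have "v t \<le> C * v (of_nat (x + j * p ^ N) - of_nat x)"
      unfolding t_def by (intro Cd(3) of_nat_Zp)
    also have "\<dots> \<le> C * (1 / real p) ^ N" using le Cd(1) by (intro mult_left_mono) auto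
    finally show "v (t * (-1) ^ (x + j)) \<le> C * (1 / real p) ^ N"
      by (simp add: v_mult v_power)
  qed (use Cd(1) in simp_all)
  have "(\<lambda>N. v (S (Suc N) - S N)) \<longlonglongrightarrow> 0"
  proof (rule tendsto_sandwich[OF _ _ tendsto_const])
    show "(\<lambda>N. C * (1 / real p) ^ N) \<longlonglongrightarrow> 0"
      by (rule tendsto_mult_right_zero[OF inverse_p_power_tendsto])
    show "\<forall>\<^sub>F N in sequentially. v (S (Suc N) - S N) \<le> C * (1 / real p) ^ N"
      using bound by (rule eventually_sequentiallyI)
  qed (simp add: v_nonneg)
  then obtain I where "v_tendsto v S I" using v_cauchy_SucI v_complete by blast
  then have "has_fermionic_integral p v f I"
    using bounded_strict_derivative_uniformly_differentiable[OF f]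
    by (simp add: has_fermionic_integral_def S_def[abs_def])
  then show ?thesis using fermionic_integral_eqI by metis
qed

section \<open>Moments of \<open>[x]_q\<close>, products of Bernstein polynomials and the integral
  formula\<close>

lemma has_fermionic_integral_q_number_power:
  assumes "odd p" and "v (1 - q) < 1"
  shows "has_fermionic_integral p v (\<lambda>x. q_number v q x ^ m) (q_euler p v m q)"
proof -
  obtain h where "bounded_strict_derivative (\<lambda>x. q_number v q x ^ m) h"
    using bounded_strict_derivative_q_number[OF assms(2)] bounded_strict_derivative_power by blast
  then show ?thesis unfolding q_euler_def by (rule fermionic_integral_exists[OF assms(1)])
qed

text \<open>With \<open>t = [x]_q\<close>, reflection turns each factor into a constant times
  \<open>t^k * (1 - t)^(n i - k)\<close>. Exponents add up over \<open>A\<close>, and the power of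
  \<open>1 - t\<close> is expanded binomially.\<close>

lemma prod_q_bernstein:
  assumes "v (1 - q) < 1" and "x \<in> Zp v" and "finite A" and n: "\<And>i. i \<in> A \<Longrightarrow> k \<le> n i"
  shows "(\<Prod>i\<in>A. q_bernstein v k (n i) x q) =
    (\<Sum>j\<le>(\<Sum>i\<in>A. n i) - card A * k. (\<Prod>i\<in>A. of_nat (n i choose k)) *
      (of_nat (((\<Sum>i\<in>A. n i) - card A * k) choose j) * (-1) ^ j) * q_number v q x ^ (j + card A * k))"
proof -
  define t where "t = q_number v q x"
  define D where "D = (\<Sum>i\<in>A. n i) - card A * k"
  \<comment> \<open>Since \<open>k \<le> n i\<close> on \<open>A\<close>, no subtraction is
    truncated and it commutes with the sum.\<close>
  have "(\<Sum>i\<in>A. n i - k) = D"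
    using n by (simp add: D_def sum_subtractf_nat)
  then have "(\<Prod>i\<in>A. q_bernstein v k (n i) x q) =
      (\<Prod>i\<in>A. of_nat (n i choose k)) * t ^ (card A * k) * (1 - t) ^ D"
    using n by (simp add: q_bernstein_def q_number_reflection[OF assms(1,2)] t_def[symmetric]
        prod.distrib power_mult[symmetric] mult.commute[of k] flip: power_sum)
  also have "(1 - t) ^ D = (\<Sum>j\<le>D. of_nat (D choose j) * (-1) ^ j * t ^ j)"
    using binomial_ring[of "- t" 1 D] by (simp add: power_minus[of t] mult.assoc)
  finally show ?thesis
    unfolding D_def[symmetric] t_def[symmetric] by (simp add: sum_distrib_left power_add mult_ac)
qed

end

theorem theorem12:
  fixes p s k :: nat and n :: "nat \<Rightarrow> nat"
    and v :: "'a::field_char_0 \<Rightarrow> real" and q :: 'a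
  assumes "prime p" and "odd p"
    and "is_Cp p v"
    and "v (1 - q) < 1"
    and "s \<ge> 1"
  shows "has_fermionic_integral p v (\<lambda>x. \<Prod>i=1..s. q_bernstein v k (n i) x q)
    ((\<Prod>i=1..s. of_nat (n i choose k)) *
      (\<Sum>j | j + s * k \<le> (\<Sum>i=1..s. n i).
        of_nat (((\<Sum>i=1..s. n i) - s * k) choose j) * (-1) ^ j * q_euler p v (j + s * k) q))"
proof -
  interpret prime_Cp p v
    by (intro prime_Cp.intro prime_Cp_axioms.intro assms)
  show ?thesis
  proof (cases "\<forall>i\<in>{1..s}. k \<le> n i")
    case True
    let ?D = "(\<Sum>i=1..s. n i) - s * k"
    let ?C = "\<Prod>i=1..s. of_nat (n i choose k) :: 'a"
    have "s * k \<le> (\<Sum>i=1..s. n i)"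
      using sum_mono[of "{1..s}" "\<lambda>_. k" n] True by simp
    \<comment> \<open>The index set in the statement expresses the empty-sum convention without
      truncated subtraction; in this case it is an honest initial segment.\<close>
    then have J: "{j. j + s * k \<le> (\<Sum>i=1..s. n i)} = {..?D}" by auto
    have "has_fermionic_integral p v
        (\<lambda>x. \<Sum>j\<le>?D. ?C * (of_nat (?D choose j) * (-1) ^ j) * q_number v q x ^ (j + s * k))
        (\<Sum>j\<le>?D. ?C * (of_nat (?D choose j) * (-1) ^ j) * q_euler p v (j + s * k) q)"
      by (intro has_fermionic_integral_sum has_fermionic_integral_cmult
          has_fermionic_integral_q_number_power assms)
    moreover have "(\<Prod>i=1..s. q_bernstein v k (n i) x q) =
        (\<Sum>j\<le>?D. ?C * (of_nat (?D choose j) * (-1) ^ j) * q_number v q x ^ (j + s * k))"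
      if "x \<in> Zp v" for x
      using prod_q_bernstein[OF assms(4) that, of "{1..s}" k n] True by simp
    ultimately show ?thesis
      unfolding J sum_distrib_left by (subst has_fermionic_integral_cong) (simp_all add: mult.assoc)
  next
    case False
    \<comment> \<open>One index with \<open>n i < k\<close> kills the integrand and the product of
      binomial coefficients, whatever the value of the sum over \<open>j\<close>.\<close>
    then obtain i where i: "i \<in> {1..s}" "\<not> k \<le> n i" by blast
    then have "(\<Prod>i=1..s. q_bernstein v k (n i) x q) = 0" for x
      by (intro prod_zero) (auto simp: q_bernstein_def)
    moreover have "(\<Prod>i=1..s. of_nat (n i choose k) :: 'a) = 0"
      using i by (intro prod_zero bexI[of _ i]) auto
    ultimately show ?thesis using has_fermionic_integral_zero by (simp only: mult_zero_left)
  qed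
qed

end
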